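(* Let $q,n$ be integers with $q\ge 2$, $n\ge 2$, and suppose $q-1$ divides $qn-1$. Then $\mathsf{id}_{(qn-1)/(q-1)}\le\mathsf{PHP}^{qn}_{n}$ if and only if there exists an $\mathrm{RBIBD}(qn,q,1)$.
   Context: A number $N\ge1$ is identified with $\{0,\dots,N-1\}$. A (finite) problem $\mathsf{P}$ consists of a nonempty finite set of instances and, for each instance $x$, a nonempty finite set $\mathsf{P}(x)$ of solutions. For finite problems $\mathsf{P},\mathsf{Q}$, write $\mathsf{P}\le\mathsf{Q}$ if there exist a map $\Phi$ sending each $\mathsf{P}$-instance $x$ to a $\mathsf{Q}$-instance $\Phi(x)$ and a (partial) map $\Psi$ on $\mathsf{Q}$-solutions such that for every $\mathsf{P}$-instance $x$ and every $y\in\mathsf{Q}(\Phi(x))$, $\Psi(y)\in\mathsf{P}(x)$. For integers $m>n\ge2$, the problem $\mathsf{PHP}^m_n$ has as instances all functions $f:m\to n$, and the solutions to $f$ are all unordered pairs $\{i,j\}\subseteq m$ with $i\ne j$ and $f(i)=f(j)$. For $k\ge1$, the problem $\mathsf{id}_k$ has instances $j\in\{1,\dots,k\}$, each instance $j$ having unique solution $j$. A $\mathrm{BIBD}(p,n,\lambda)$ is a finite set $V$ of $p$ points together with a collection of $n$-element subsets of $V$ (blocks) such that every pair of distinct points lies in exactly $\lambda$ blocks; an $\mathrm{RBIBD}(p,n,\lambda)$ is a $\mathrm{BIBD}(p,n,\lambda)$ whose blocks can be partitioned into parallel classes such that each point lies in exactly one block of each parallel class. *)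

theory Defs
  imports Main "HOL-Library.FuncSet" "HOL-Library.Multiset"
begin

record ('a, 'b) problem =
  instances :: "'a set"
  solutions :: "'a \<Rightarrow> 'b set"

definition finite_problem :: "('a, 'b) problem \<Rightarrow> bool" where
  "finite_problem P \<longleftrightarrow>
     finite (instances P) \<and> instances P \<noteq> {} \<and>
     (\<forall>x\<in>instances P. finite (solutions P x) \<and> solutions P x \<noteq> {})"

definition all_solutions :: "('a, 'b) problem \<Rightarrow> 'b set" where
  "all_solutions P = (\<Union>x\<in>instances P. solutions P x)"

definition problem_le :: "('a, 'b) problem \<Rightarrow> ('c, 'd) problem \<Rightarrow> bool"
    (infix \<open>\<le>\<^sub>P\<close> 50) where
  "P \<le>\<^sub>P Q \<longleftrightarrow>
     (\<exists>\<Phi> \<Psi>. \<Phi> ` instances P \<subseteq> instances Q \<and> dom \<Psi> \<subseteq> all_solutions Q \<and>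
        (\<forall>x\<in>instances P. \<forall>y\<in>solutions Q (\<Phi> x). \<exists>z\<in>solutions P x. \<Psi> y = Some z))"

definition PHP :: "nat \<Rightarrow> nat \<Rightarrow> (nat \<Rightarrow> nat, nat set) problem" where
  "PHP m n =
     \<lparr>instances = {..<m} \<rightarrow>\<^sub>E {..<n},
      solutions = (\<lambda>f. {{i, j} | i j. i < m \<and> j < m \<and> i \<noteq> j \<and> f i = f j})\<rparr>"

definition id_problem :: "nat \<Rightarrow> (nat, nat) problem" where
  "id_problem k = \<lparr>instances = {1..k}, solutions = (\<lambda>j. {j})\<rparr>"

lemma finite_problem_PHP:
  assumes "m > n" and "n \<ge> 2"
  shows "finite_problem (PHP m n)"
proof -
  have "finite (solutions (PHP m n) f)" for f
    by (rule finite_subset[of _ "Pow {..<m}"]) (auto simp: PHP_def)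
  moreover have "solutions (PHP m n) f \<noteq> {}" if "f \<in> instances (PHP m n)" for f
  proof -
    have "f ` {..<m} \<subseteq> {..<n}"
      using that by (auto simp: PHP_def)
    then have "card (f ` {..<m}) \<le> n"
      by (metis card_lessThan card_mono finite_lessThan)
    then have "\<not> inj_on f {..<m}"
      using assms(1) by (auto dest: card_image)
    then show ?thesis
      by (auto simp: PHP_def inj_on_def)
  qed
  moreover have "finite (instances (PHP m n))"
    by (simp add: PHP_def finite_PiE)
  moreover have "instances (PHP m n) \<noteq> {}"
    using assms by (auto simp: PHP_def PiE_eq_empty_iff lessThan_empty_iff)
  ultimately show ?thesis
    by (simp add: finite_problem_def)
qed

lemma finite_problem_id_problem:
  "k \<ge> 1 \<Longrightarrow> finite_problem (id_problem k)"
  by (simp add: finite_problem_def id_problem_def)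

text \<open>
  Blocks form a multiset, so repeated blocks are allowed, as is usual for
  \<open>\<lambda> > 1\<close>. For \<open>\<lambda> = 1\<close> and block size at least 2 no block can repeat.
\<close>

definition BIBD :: "'a set \<Rightarrow> 'a set multiset \<Rightarrow> nat \<Rightarrow> nat \<Rightarrow> nat \<Rightarrow> bool" where
  "BIBD V \<B> p n l \<longleftrightarrow>
     finite V \<and> card V = p \<and>
     (\<forall>b\<in>#\<B>. b \<subseteq> V \<and> card b = n) \<and>
     (\<forall>x\<in>V. \<forall>y\<in>V. x \<noteq> y \<longrightarrow> size {#b \<in># \<B>. x \<in> b \<and> y \<in> b#} = l)"

definition parallel_class :: "'a set \<Rightarrow> 'a set multiset \<Rightarrow> bool" where
  "parallel_class V \<C> \<longleftrightarrow> (\<forall>x\<in>V. size {#b \<in># \<C>. x \<in> b#} = 1)"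

text \<open>A partition of the multiset of blocks is a multiset of multisets with union \<open>\<B>\<close>.\<close>

definition RBIBD :: "'a set \<Rightarrow> 'a set multiset \<Rightarrow> nat \<Rightarrow> nat \<Rightarrow> nat \<Rightarrow> bool" where
  "RBIBD V \<B> p n l \<longleftrightarrow>
     BIBD V \<B> p n l \<and>
     (\<exists>R. \<Sum>\<^sub># R = \<B> \<and> (\<forall>\<C>\<in>#R. parallel_class V \<C>))"

end

theory Submission imports Defs begin

text \<open>
  A reduction of \<open>id\<^sub>k\<close> to \<open>PHP\<close> amounts to \<open>k\<close> maps from \<open>q n\<close> points to \<open>n\<close> colours such that
  no pair of points is monochromatic for two of them. If a map has fibres of sizes \<open>s\<^sub>c\<close>, its number
  of ordered monochromatic pairs is \<open>q n (q - 1) + \<Sum>\<^sub>c (s\<^sub>c - q)\<^sup>2\<close>. Since \<open>k (q - 1) = q n - 1\<close>,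
  disjointness leaves no slack: all fibres have size \<open>q\<close> and every pair is monochromatic for exactly
  one map, so the fibres are the blocks of an RBIBD and the maps are its parallel classes.
  Conversely, double counting shows that an RBIBD has exactly \<open>k\<close> parallel classes of \<open>n\<close> blocks
  each, and mapping a point to the index of its block in the class gives the required maps.
\<close>

section \<open>Reductions to the pigeonhole problem as families of colourings\<close>

text \<open>Since \<open>j\<close> is the only solution of instance \<open>j\<close>,
  \<open>\<Psi>\<close> must read \<open>j\<close> off every pair that is monochromatic for
  \<open>\<Phi> j\<close>. Such a decoder exists exactly when no pair is monochromatic for two of
  the colourings.\<close>

lemma id_problem_le_PHP_iff:
  "id_problem k \<le>\<^sub>P PHP m n \<longleftrightarrow>
     (\<exists>f. (\<forall>j\<in>{1..k}. f j \<in> {..<m} \<rightarrow> {..<n}) \<and>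
          (\<forall>i\<in>{1..k}. \<forall>j\<in>{1..k}. \<forall>a<m. \<forall>b<m.
             a \<noteq> b \<and> f i a = f i b \<and> f j a = f j b \<longrightarrow> i = j))"
  (is "?L \<longleftrightarrow> (\<exists>f. ?maps f \<and> ?disj f)")
proof
  assume ?L
  then obtain \<Phi> \<Psi> where
    le: "\<Phi> ` instances (id_problem k) \<subseteq> instances (PHP m n)"
      "\<forall>x\<in>instances (id_problem k). \<forall>y\<in>solutions (PHP m n) (\<Phi> x).
         \<exists>z\<in>solutions (id_problem k) x. \<Psi> y = Some z"
    unfolding problem_le_def by blast
  have inst: "\<Phi> ` {1..k} \<subseteq> {..<m} \<rightarrow>\<^sub>E {..<n}"
    using le(1) by (simp add: id_problem_def PHP_def)
  have sol: "\<Psi> y = Some j" if "j \<in> {1..k}" "y \<in> solutions (PHP m n) (\<Phi> j)" for j y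
    using le(2) that by (simp add: id_problem_def)
  have "?maps \<Phi>"
    using inst by (auto simp: PiE_def)
  moreover have "?disj \<Phi>"
  proof (intro ballI allI impI)
    fix i j a b
    assume *: "i \<in> {1..k}" "j \<in> {1..k}" "a < m" "b < m"
      "a \<noteq> b \<and> \<Phi> i a = \<Phi> i b \<and> \<Phi> j a = \<Phi> j b"
    then have "{a, b} \<in> solutions (PHP m n) (\<Phi> i)" "{a, b} \<in> solutions (PHP m n) (\<Phi> j)"
      by (auto simp: PHP_def)
    then show "i = j"
      using sol * by (metis option.inject)
  qed
  ultimately show "\<exists>f. ?maps f \<and> ?disj f" by blast
next
  assume "\<exists>f. ?maps f \<and> ?disj f"
  then obtain f where maps: "?maps f" and disj: "?disj f" by blast
  \<comment> \<open>Instances of \<open>PHP\<close> are extensional, so \<open>f j\<close> is cut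
    off outside the points; its monochromatic pairs stay the same.\<close>
  define \<Phi> where "\<Phi> j = restrict (f j) {..<m}" for j
  define Q where "Q y j \<longleftrightarrow> j \<in> {1..k} \<and> y \<in> solutions (PHP m n) (\<Phi> j)" for y j
  \<comment> \<open>Pairs that no colouring identifies are sent to \<open>None\<close>, which keeps
    \<open>dom \<Psi>\<close> inside the solutions; on the others \<open>uniq\<close> justifies
    \<open>THE\<close>.\<close>
  define \<Psi> where "\<Psi> y = (if \<exists>j. Q y j then Some (THE j. Q y j) else None)" for y
  have uniq: "i = j" if Q: "Q y i" "Q y j" for y i j
  proof -
    obtain a b where ab: "y = {a, b}" "a < m" "b < m" "a \<noteq> b" "f i a = f i b"
      using Q(1) by (auto simp: Q_def \<Phi>_def PHP_def)
    obtain c d where cd: "y = {c, d}" "c < m" "d < m" "c \<noteq> d" "f j c = f j d"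
      using Q(2) by (auto simp: Q_def \<Phi>_def PHP_def)
    have "f j a = f j b"
      using ab(1) cd by (auto simp: doubleton_eq_iff)
    then show ?thesis
      using disj ab Q unfolding Q_def by blast
  qed
  have "\<Psi> y = Some j" if "Q y j" for y j
    using that uniq the_equality[of "Q y" j] by (metis \<Psi>_def)
  moreover have inst: "\<Phi> ` {1..k} \<subseteq> {..<m} \<rightarrow>\<^sub>E {..<n}"
    using maps by (auto simp: \<Phi>_def simp del: atLeastAtMost_iff intro!: restrict_PiE_iff[THEN iffD2])
  moreover have "dom \<Psi> \<subseteq> all_solutions (PHP m n)"
  proof
    fix y assume "y \<in> dom \<Psi>"
    then obtain j where "Q y j" by (auto simp: \<Psi>_def split: if_splits)
    moreover have "\<Phi> j \<in> instances (PHP m n)" if "j \<in> {1..k}"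
      using inst that by (simp add: PHP_def image_subset_iff)
    ultimately show "y \<in> all_solutions (PHP m n)"
      by (auto simp: all_solutions_def Q_def)
  qed
  ultimately show ?L
    unfolding problem_le_def
    by (intro exI[of _ \<Phi>] exI[of _ \<Psi>]) (auto simp: id_problem_def PHP_def Q_def)
qed

section \<open>Counting monochromatic pairs\<close>

text \<open>With the diagonal added, the pairs are counted by the squares of the fibre sizes. These
  sizes sum to \<open>q * n\<close>, so expanding the squares about \<open>q\<close> leaves the
  squared deviations. Integers are used because a deviation may be negative.\<close>

lemma card_monochromatic_pairs:
  fixes f :: "'a \<Rightarrow> nat"
  assumes "finite V" and "card V = q * n" and "f \<in> V \<rightarrow> {..<n}"
  shows "int (card {(a, b). a \<in> V \<and> b \<in> V \<and> a \<noteq> b \<and> f a = f b}) =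
           int (q * n) * (int q - 1) + (\<Sum>c<n. (int (card {a \<in> V. f a = c}) - int q)\<^sup>2)"
proof -
  define F where "F c = {a \<in> V. f a = c}" for c
  define S where "S = {(a, b). a \<in> V \<and> b \<in> V \<and> a \<noteq> b \<and> f a = f b}"
  have fin: "finite (F c)" for c
    using assms(1) by (simp add: F_def)
  have disj: "\<forall>c\<in>{..<n}. \<forall>d\<in>{..<n}. c \<noteq> d \<longrightarrow> F c \<inter> F d = {}"
    by (auto simp: F_def)
  have "V = (\<Union>c<n. F c)"
    using assms(3) by (auto simp: F_def)
  then have "card V = card (\<Union>c<n. F c)"
    by (rule arg_cong)
  also have "\<dots> = (\<Sum>c<n. card (F c))"
    using fin disj by (intro card_UN_disjoint) simp_all
  finally have "card V = (\<Sum>c<n. card (F c))" .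
  then have sum1: "(\<Sum>c<n. int (card (F c))) = int (q * n)"
    using assms(2) by simp
  \<comment> \<open>Adding the diagonal yields a disjoint union of squares, at the cost of
    \<open>card V\<close> extra pairs.\<close>
  have "S \<union> Id_on V = (\<Union>c<n. F c \<times> F c)"
    using assms(3) by (auto simp: S_def F_def)
  then have "card (S \<union> Id_on V) = card (\<Union>c<n. F c \<times> F c)"
    by (rule arg_cong)
  also have "\<dots> = (\<Sum>c<n. card (F c \<times> F c))"
    using fin disj by (intro card_UN_disjoint) (auto simp: Times_Int_Times)
  finally have "card (S \<union> Id_on V) = (\<Sum>c<n. card (F c) * card (F c))"
    by (simp add: card_cartesian_product)
  moreover have "card (S \<union> Id_on V) = card S + card V"
  proof -
    have "S \<subseteq> V \<times> V" by (auto simp: S_def)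
    then have "finite S"
      using assms(1) finite_subset by blast
    moreover have "Id_on V = (\<lambda>a. (a, a)) ` V" by auto
    moreover have "card ((\<lambda>a. (a, a)) ` V) = card V"
      by (rule card_image) (simp add: inj_on_def)
    ultimately show ?thesis
      using assms(1) by (subst card_Un_disjoint) (auto simp: S_def)
  qed
  ultimately have "int (card S) + int (q * n) = (\<Sum>c<n. (int (card (F c)))\<^sup>2)"
    using assms(2) by (metis (no_types, lifting) of_nat_add of_nat_mult of_nat_sum power2_eq_square sum.cong)
  moreover have "(\<Sum>c<n. (int (card (F c)) - int q)\<^sup>2) =
      (\<Sum>c<n. (int (card (F c)))\<^sup>2) - 2 * int q * (\<Sum>c<n. int (card (F c))) + int n * (int q)\<^sup>2"
    by (simp add: power2_diff sum.distrib sum_subtractf sum_distrib_left algebra_simps)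
  ultimately show ?thesis
    using sum1 by (simp add: S_def F_def power2_eq_square algebra_simps)
qed

lemma card_off_diagonal:
  assumes "finite V"
  shows "card {(a, b). a \<in> V \<and> b \<in> V \<and> a \<noteq> b} = card V * (card V - 1)"
proof -
  have "{(a, b). a \<in> V \<and> b \<in> V \<and> a \<noteq> b} = (SIGMA a:V. V - {a})" by auto
  then show ?thesis
    using assms by simp
qed

text \<open>The sets \<open>S j\<close> are disjoint subsets of \<open>D\<close>, each exceeding
  \<open>q * n * (q - 1)\<close> by \<open>t j \<ge> 0\<close>. As \<open>k\<close> times this bound
  is already \<open>card D\<close>, every excess vanishes and the \<open>S j\<close> exhaust
  \<open>D\<close>. The first fact gives the fibre sizes, the second the covering of pairs.\<close>

lemma disjoint_colourings_tight:
  fixes f :: "nat \<Rightarrow> 'a \<Rightarrow> nat"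
  assumes "finite V" and card_V: "card V = q * n" and "q * n > 0" and k: "k * (q - 1) = q * n - 1"
    and maps: "\<And>j. j \<in> {1..k} \<Longrightarrow> f j \<in> V \<rightarrow> {..<n}"
    and disj: "\<And>i j a b. \<lbrakk>i \<in> {1..k}; j \<in> {1..k}; a \<in> V; b \<in> V; a \<noteq> b;
                 f i a = f i b; f j a = f j b\<rbrakk> \<Longrightarrow> i = j"
  shows fibres_uniform: "\<And>j c. j \<in> {1..k} \<Longrightarrow> c < n \<Longrightarrow> card {a \<in> V. f j a = c} = q"
    and pairs_covered: "\<And>a b. a \<in> V \<Longrightarrow> b \<in> V \<Longrightarrow> a \<noteq> b \<Longrightarrow> \<exists>j\<in>{1..k}. f j a = f j b"
proof -
  define S where "S j = {(a, b). a \<in> V \<and> b \<in> V \<and> a \<noteq> b \<and> f j a = f j b}" for j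
  define D where "D = {(a, b). a \<in> V \<and> b \<in> V \<and> a \<noteq> b}"
  define t where "t j = (\<Sum>c<n. (int (card {a \<in> V. f j a = c}) - int q)\<^sup>2)" for j
  have "D \<subseteq> V \<times> V" by (auto simp: D_def)
  then have finD: "finite D"
    using assms(1) finite_subset by blast
  have SD: "S j \<subseteq> D" for j by (auto simp: S_def D_def)
  have UD: "(\<Union>j\<in>{1..k}. S j) \<subseteq> D" using SD by blast
  have "card (\<Union>j\<in>{1..k}. S j) = (\<Sum>j\<in>{1..k}. card (S j))"
  proof (rule card_UN_disjoint)
    show "\<forall>i\<in>{1..k}. \<forall>j\<in>{1..k}. i \<noteq> j \<longrightarrow> S i \<inter> S j = {}"
      using disj unfolding S_def by fast
  qed (use finite_subset[OF SD finD] in auto)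
  also have "int \<dots> = (\<Sum>j\<in>{1..k}. int (q * n) * (int q - 1) + t j)"
    unfolding of_nat_sum S_def t_def
    by (intro sum.cong refl card_monochromatic_pairs assms(1) card_V maps)
  also have "\<dots> = int k * int (q * n) * (int q - 1) + (\<Sum>j\<in>{1..k}. t j)"
    by (simp add: sum.distrib)
  \<comment> \<open>The equation for \<open>k\<close> enters here; \<open>q \<ge> 1\<close>
    reconciles truncated subtraction with that of the integers.\<close>
  also have "int k * int (q * n) * (int q - 1) = int (card D)"
  proof -
    have "q \<ge> 1" using assms(3) by (cases q) auto
    then have "int k * (int q - 1) = int (q * n - 1)"
      unfolding k[symmetric] by (simp add: of_nat_diff)
    moreover have "card D = q * n * (q * n - 1)"
      using card_off_diagonal[OF assms(1)] card_V by (simp add: D_def)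
    ultimately show ?thesis by (simp add: mult.left_commute mult.commute)
  qed
  finally have eq: "int (card (\<Union>j\<in>{1..k}. S j)) = int (card D) + (\<Sum>j\<in>{1..k}. t j)" .
  have t_nonneg: "t j \<ge> 0" for j by (simp add: t_def sum_nonneg)
  have le: "card (\<Union>j\<in>{1..k}. S j) \<le> card D"
    by (rule card_mono[OF finD UD])
  have "(\<Sum>j\<in>{1..k}. t j) \<ge> 0" by (simp add: t_nonneg sum_nonneg)
  with eq le have sum0: "(\<Sum>j\<in>{1..k}. t j) = 0" by linarith
  then have t0: "t j = 0" if "j \<in> {1..k}" for j
    using that t_nonneg by (simp add: sum_nonneg_eq_0_iff)
  show "card {a \<in> V. f j a = c} = q" if "j \<in> {1..k}" "c < n" for j c
    using t0[OF that(1)] that(2) by (simp add: t_def sum_nonneg_eq_0_iff)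
  have "(\<Union>j\<in>{1..k}. S j) = D"
    using eq sum0 by (intro card_subset_eq[OF finD UD]) simp
  moreover have "(a, b) \<in> D" if "a \<in> V" "b \<in> V" "a \<noteq> b" for a b
    using that by (simp add: D_def)
  ultimately show "\<exists>j\<in>{1..k}. f j a = f j b" if "a \<in> V" "b \<in> V" "a \<noteq> b" for a b
    using that unfolding S_def by blast
qed

section \<open>The resolvable design of a family of colourings\<close>

lemma size_filter_Union_mset:
  "size (filter_mset P (\<Sum>\<^sub># R)) = (\<Sum>C\<in>#R. size (filter_mset P C))"
  by (induction R) auto

text \<open>The fibres of one colouring partition \<open>V\<close> and so form a parallel class. A
  pair lies in one block for each colouring that identifies it, hence in exactly one block
  overall.\<close>

lemma RBIBD_of_colourings:
  fixes f :: "nat \<Rightarrow> 'a \<Rightarrow> nat"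
  assumes "finite V" and "card V = q * n"
    and maps: "\<And>j. j \<in> {1..k} \<Longrightarrow> f j \<in> V \<rightarrow> {..<n}"
    and fibres: "\<And>j c. j \<in> {1..k} \<Longrightarrow> c < n \<Longrightarrow> card {a \<in> V. f j a = c} = q"
    and pairs: "\<And>a b. a \<in> V \<Longrightarrow> b \<in> V \<Longrightarrow> a \<noteq> b \<Longrightarrow> \<exists>!j. j \<in> {1..k} \<and> f j a = f j b"
  shows "\<exists>\<B>. RBIBD V \<B> (q * n) q 1"
proof -
  \<comment> \<open>One block per colour: filter sizes become cardinalities of sets of colours,
    without showing that different colours have different fibres.\<close>
  define C where "C j = image_mset (\<lambda>c. {a \<in> V. f j a = c}) (mset_set {..<n})" for j
  define R where "R = image_mset C (mset_set {1..k})"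
  have size_C: "size (filter_mset P (C j)) = card {c. c < n \<and> P {a \<in> V. f j a = c}}" for P j
    by (simp add: C_def filter_mset_image_mset)
  have "size {#b \<in># \<Sum>\<^sub># R. x \<in> b \<and> y \<in> b#} = 1" if xy: "x \<in> V" "y \<in> V" "x \<noteq> y" for x y
  proof -
    have "size {#b \<in># C j. x \<in> b \<and> y \<in> b#} = (if f j x = f j y then 1 else 0)"
      if "j \<in> {1..k}" for j
    proof -
      have "{c. c < n \<and> x \<in> {a \<in> V. f j a = c} \<and> y \<in> {a \<in> V. f j a = c}} =
          (if f j x = f j y then {f j x} else {})"
        using xy maps[OF that] by auto
      then show ?thesis by (simp add: size_C)
    qed
    then have "size {#b \<in># \<Sum>\<^sub># R. x \<in> b \<and> y \<in> b#} =
        (\<Sum>j\<in>{1..k}. if f j x = f j y then 1 else 0)"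
      unfolding size_filter_Union_mset R_def image_mset.compositionality comp_def sum_unfold_sum_mset
      by (intro arg_cong[where f = sum_mset] image_mset_cong) simp
    also have "\<dots> = card {j \<in> {1..k}. f j x = f j y}"
      by (simp flip: sum.inter_filter)
    also have "\<dots> = 1"
      using pairs[OF xy] by (simp add: card_1_singleton_iff) blast
    finally show ?thesis .
  qed
  moreover have "b \<subseteq> V \<and> card b = q" if "b \<in># \<Sum>\<^sub># R" for b
    using that fibres by (auto simp: R_def C_def)
  moreover have "parallel_class V (C j)" if "j \<in> {1..k}" for j
    unfolding parallel_class_def
  proof
    fix x assume "x \<in> V"
    then have "{c. c < n \<and> x \<in> {a \<in> V. f j a = c}} = {f j x}"
      using maps[OF that] by auto
    then show "size {#b \<in># C j. x \<in> b#} = 1" by (simp add: size_C)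
  qed
  then have "\<forall>\<C>\<in>#R. parallel_class V \<C>" by (auto simp: R_def)
  ultimately show ?thesis
    using assms(1,2) unfolding RBIBD_def BIBD_def by blast
qed

section \<open>Double counting in designs\<close>

text \<open>Incidences \<open>x \<in> b\<close> are counted block by block and point by
  point.\<close>

lemma sum_card_blocks:
  assumes "finite V" and "\<forall>b\<in>#M. b \<subseteq> V"
  shows "(\<Sum>b\<in>#M. card b) = (\<Sum>x\<in>V. size {#b \<in># M. x \<in> b#})"
  using assms(2)
proof (induction M)
  case (add b M)
  have "(\<Sum>x\<in>V. if x \<in> b then 1 else 0) = card b"
    using add.prems assms(1) by (simp flip: sum.inter_filter) (metis Int_absorb1 Int_def)
  moreover have "size {#c \<in># add_mset b M. x \<in> c#} =
      (if x \<in> b then 1 else 0) + size {#c \<in># M. x \<in> c#}" for x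
    by simp
  ultimately show ?case
    using add by (simp only: sum.distrib) simp
qed simp

text \<open>Each block has \<open>q\<close> incidences and each of the \<open>q * n\<close> points
  has one.\<close>

lemma parallel_class_size:
  assumes "finite V" and "card V = q * n" and "q > 0"
    and "\<forall>b\<in>#C. b \<subseteq> V \<and> card b = q" and "parallel_class V C"
  shows "size C = n"
proof -
  have "(\<Sum>b\<in>#C. card b) = (\<Sum>b\<in>#C. q)"
    using assms(4) by (intro arg_cong[where f = sum_mset] image_mset_cong) auto
  moreover have "(\<Sum>b\<in>#C. card b) = q * n"
    using sum_card_blocks[of V C] assms by (simp add: parallel_class_def)
  ultimately show ?thesis
    using assms(3) by simp
qed

text \<open>Fix a point \<open>x\<close>. Each class contributes one block through \<open>x\<close>,
  and these blocks without \<open>x\<close> cover every other point exactly once.\<close>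

lemma number_of_parallel_classes:
  assumes bibd: "BIBD V (\<Sum>\<^sub># R) p q 1" and "p > 0" and par: "\<forall>C\<in>#R. parallel_class V C"
  shows "size R * (q - 1) = p - 1"
proof -
  have V: "finite V" "card V = p"
    and blocks: "\<And>b. b \<in># \<Sum>\<^sub># R \<Longrightarrow> b \<subseteq> V \<and> card b = q"
    and pairs: "\<And>x y. x \<in> V \<Longrightarrow> y \<in> V \<Longrightarrow> x \<noteq> y \<Longrightarrow> size {#b \<in># \<Sum>\<^sub># R. x \<in> b \<and> y \<in> b#} = 1"
    using bibd by (auto simp: BIBD_def)
  obtain x where x: "x \<in> V"
    using V assms(2) by fastforce
  define N where "N = {#b \<in># \<Sum>\<^sub># R. x \<in> b#}"
  have "size N = (\<Sum>C\<in>#R. 1)"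
    unfolding N_def size_filter_Union_mset
    using par x by (intro arg_cong[where f = sum_mset] image_mset_cong) (auto simp: parallel_class_def)
  then have size_N: "size N = size R" by simp
  \<comment> \<open>Deleting \<open>x\<close> leaves blocks of size \<open>q - 1\<close> inside
    \<open>V - {x}\<close>, ready for \<open>sum_card_blocks\<close>.\<close>
  define M where "M = image_mset (\<lambda>b. b - {x}) N"
  have "(\<Sum>b\<in>#M. card b) = (\<Sum>b\<in>#N. q - 1)"
    unfolding M_def image_mset.compositionality
    using blocks by (intro arg_cong[where f = sum_mset] image_mset_cong) (auto simp: N_def)
  moreover have "(\<Sum>b\<in>#M. card b) = (\<Sum>y\<in>V - {x}. size {#b \<in># M. y \<in> b#})"
    using V blocks by (intro sum_card_blocks) (auto simp: M_def N_def)
  moreover have "size {#b \<in># M. y \<in> b#} = 1" if "y \<in> V - {x}" for y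
  proof -
    have "size {#b \<in># M. y \<in> b#} = size {#b \<in># \<Sum>\<^sub># R. x \<in> b \<and> y \<in> b#}"
      using that by (simp add: M_def N_def filter_mset_image_mset filter_filter_mset conj_commute)
    then show ?thesis
      using that x pairs by auto
  qed
  ultimately show ?thesis
    using V x size_N by simp
qed

section \<open>The colourings of a resolvable design\<close>

lemma parallel_class_index:
  assumes par: "parallel_class V (mset bs)" and "x \<in> V"
  shows "\<exists>i<length bs. x \<in> bs ! i"
proof -
  have "{#b \<in># mset bs. x \<in> b#} \<noteq> {#}"
    using assms unfolding parallel_class_def by (metis size_empty zero_neq_one)
  then show ?thesis
    by (auto simp: multiset_eq_iff in_set_conv_nth split: if_splits)
qed

text \<open>In class \<open>j\<close> a point gets as colour the position of a block containing it.
  Points of equal colour share a block of that class; if this happened in two classes, the pair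
  would lie in two blocks.\<close>

lemma colourings_of_RBIBD:
  assumes "RBIBD V \<B> (q * n) q 1" and "q \<ge> 2" and "n \<ge> 1"
    and k: "k * (q - 1) = q * n - 1"
  shows "\<exists>f :: nat \<Rightarrow> 'a \<Rightarrow> nat.
           (\<forall>j<k. f j \<in> V \<rightarrow> {..<n}) \<and>
           (\<forall>i<k. \<forall>j<k. \<forall>a\<in>V. \<forall>b\<in>V. a \<noteq> b \<and> f i a = f i b \<and> f j a = f j b \<longrightarrow> i = j)"
proof -
  obtain R where bibd: "BIBD V (\<Sum>\<^sub># R) (q * n) q 1" and par: "\<forall>C\<in>#R. parallel_class V C"
    using assms(1) by (auto simp: RBIBD_def)
  have V: "finite V" "card V = q * n"
    and blocks: "\<And>b. b \<in># \<Sum>\<^sub># R \<Longrightarrow> b \<subseteq> V \<and> card b = q"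
    and pairs: "\<And>x y. x \<in> V \<Longrightarrow> y \<in> V \<Longrightarrow> x \<noteq> y \<Longrightarrow> size {#b \<in># \<Sum>\<^sub># R. x \<in> b \<and> y \<in> b#} = 1"
    using bibd by (auto simp: BIBD_def)
  have "size R * (q - 1) = k * (q - 1)"
    using number_of_parallel_classes[OF bibd _ par] assms(2,3) k by simp
  \<comment> \<open>\<open>q \<ge> 2\<close> permits cancelling \<open>q - 1\<close>.\<close>
  then have size_R: "size R = k"
    using assms(2) by simp
  \<comment> \<open>Classes are numbered by list position, so even equal members of \<open>R\<close>
    would be kept apart.\<close>
  obtain Cs where Cs: "mset Cs = R" using ex_mset by blast
  have len_Cs: "length Cs = k"
    using Cs size_R by auto
  define L where "L j = (SOME bs. mset bs = Cs ! j)" for j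
  have L: "mset (L j) = Cs ! j" for j
    unfolding L_def by (rule someI_ex) (rule ex_mset)
  have in_R: "Cs ! j \<in># R" if "j < k" for j
    using that Cs len_Cs by auto
  have len_L: "length (L j) = n" if "j < k" for j
  proof -
    have "size (Cs ! j) = n"
      using in_R[OF that] blocks par V assms(2) by (intro parallel_class_size[of V q]) auto
    then show ?thesis by (metis L size_mset)
  qed
  define f where "f j x = (SOME i. i < length (L j) \<and> x \<in> L j ! i)" for j x
  have f: "f j x < length (L j) \<and> x \<in> L j ! f j x" if "j < k" "x \<in> V" for j x
    unfolding f_def
    by (rule someI_ex) (use parallel_class_index[of V "L j" x] in_R[OF that(1)] par L that in auto)
  have same_block: "size {#b \<in># Cs ! j. a \<in> b \<and> b' \<in> b#} \<ge> 1"
    if "j < k" "a \<in> V" "b' \<in> V" "f j a = f j b'" for j a b'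
  proof -
    have "L j ! f j a \<in># {#b \<in># Cs ! j. a \<in> b \<and> b' \<in> b#}"
      using f[of j a] f[of j b'] that by (simp flip: L)
    then show ?thesis
      by (metis One_nat_def Suc_leI empty_not_add_mset mset_add nonempty_has_size)
  qed
  have "i = j" if ij: "i < k" "j < k" and ab: "a \<in> V" "b \<in> V" "a \<noteq> b"
    and eq: "f i a = f i b" "f j a = f j b" for i j a b
  proof (rule ccontr)
    assume "i \<noteq> j"
    let ?g = "\<lambda>l. size {#B \<in># Cs ! l. a \<in> B \<and> b \<in> B#}"
    have "1 = (\<Sum>C\<in>#mset Cs. size {#B \<in># C. a \<in> B \<and> b \<in> B#})"
      using pairs[OF ab] by (simp add: size_filter_Union_mset Cs)
    \<comment> \<open>The blocks containing both points are counted class by class; the distinct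
      positions \<open>i\<close> and \<open>j\<close> already contribute at least two.\<close>
    also have "\<dots> = (\<Sum>l<k. ?g l)"
      by (simp add: sum_mset_sum_list sum_list_sum_nth len_Cs atLeast0LessThan flip: mset_map)
    also have "\<dots> \<ge> (\<Sum>l\<in>{i, j}. ?g l)"
      using ij by (intro sum_mono2) auto
    finally have "?g i + ?g j \<le> 1"
      using \<open>i \<noteq> j\<close> by simp
    then show False
      using same_block[OF ij(1) ab(1,2) eq(1)] same_block[OF ij(2) ab(1,2) eq(2)] by linarith
  qed
  moreover have "f j \<in> V \<rightarrow> {..<n}" if "j < k" for j
    using f that len_L by auto
  ultimately show ?thesis by blast
qed

theorem theorem2p15:
  fixes q n :: nat
  assumes "q \<ge> 2" and "n \<ge> 2" and "(q - 1) dvd (q * n - 1)"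
  shows "id_problem ((q * n - 1) div (q - 1)) \<le>\<^sub>P PHP (q * n) n \<longleftrightarrow>
         (\<exists>(V :: nat set) \<B>. RBIBD V \<B> (q * n) q 1)"
proof -
  define k where "k = (q * n - 1) div (q - 1)"
  \<comment> \<open>Divisibility makes the quotient exact.\<close>
  have k: "k * (q - 1) = q * n - 1"
    using assms(3) by (simp add: k_def)
  have pos: "q * n > 0" and "n \<ge> 1" using assms by simp_all
  show ?thesis
    unfolding k_def[symmetric] id_problem_le_PHP_iff
  proof
    assume "\<exists>f. (\<forall>j\<in>{1..k}. f j \<in> {..<q * n} \<rightarrow> {..<n}) \<and>
      (\<forall>i\<in>{1..k}. \<forall>j\<in>{1..k}. \<forall>a<q * n. \<forall>b<q * n.
         a \<noteq> b \<and> f i a = f i b \<and> f j a = f j b \<longrightarrow> i = j)"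
    then obtain f :: "nat \<Rightarrow> nat \<Rightarrow> nat" where
      f: "\<forall>j\<in>{1..k}. f j \<in> {..<q * n} \<rightarrow> {..<n}"
        "\<forall>i\<in>{1..k}. \<forall>j\<in>{1..k}. \<forall>a<q * n. \<forall>b<q * n.
           a \<noteq> b \<and> f i a = f i b \<and> f j a = f j b \<longrightarrow> i = j"
      by blast
    have maps: "f j \<in> {..<q * n} \<rightarrow> {..<n}" if "j \<in> {1..k}" for j
      using f(1) that by blast
    have disj: "i = j" if "i \<in> {1..k}" "j \<in> {1..k}" "a \<in> {..<q * n}" "b \<in> {..<q * n}" "a \<noteq> b"
      "f i a = f i b" "f j a = f j b" for i j a b
      using f(2)[rule_format, of i j a b] that by simp
    \<comment> \<open>Existence comes from tightness of the count, uniqueness from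
      disjointness.\<close>
    have pairs: "\<exists>!j. j \<in> {1..k} \<and> f j a = f j b"
      if "a \<in> {..<q * n}" "b \<in> {..<q * n}" "a \<noteq> b" for a b
    proof -
      have "\<exists>j\<in>{1..k}. f j a = f j b"
        by (rule pairs_covered[where f = f and V = "{..<q * n}" and q = q and n = n];
            (fact pos k maps disj that | simp))
      then show ?thesis
        using disj[OF _ _ that] by (metis (no_types, lifting))
    qed
    have fibres: "card {a \<in> {..<q * n}. f j a = c} = q" if "j \<in> {1..k}" "c < n" for j c
      by (rule fibres_uniform[where f = f and V = "{..<q * n}" and k = k and n = n];
          (fact pos k maps disj that | simp))
    have "\<exists>\<B>. RBIBD {..<q * n} \<B> (q * n) q 1"
      by (rule RBIBD_of_colourings[where f = f and k = k]; (fact maps fibres pairs | simp))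
    then show "\<exists>(V :: nat set) \<B>. RBIBD V \<B> (q * n) q 1" by blast
  next
    assume "\<exists>(V :: nat set) \<B>. RBIBD V \<B> (q * n) q 1"
    then obtain V :: "nat set" and \<B> where rbibd: "RBIBD V \<B> (q * n) q 1" by blast
    then obtain f :: "nat \<Rightarrow> nat \<Rightarrow> nat" where
      f: "\<forall>j<k. f j \<in> V \<rightarrow> {..<n}"
        "\<forall>i<k. \<forall>j<k. \<forall>a\<in>V. \<forall>b\<in>V. a \<noteq> b \<and> f i a = f i b \<and> f j a = f j b \<longrightarrow> i = j"
      using colourings_of_RBIBD[OF rbibd assms(1) _ k] \<open>n \<ge> 1\<close> by blast
    have maps: "f j \<in> V \<rightarrow> {..<n}" if "j < k" for j
      using f(1) that by blast
    have disj: "i = j" if "i < k" "j < k" "a \<in> V" "b \<in> V" "a \<noteq> b" "f i a = f i b" "f j a = f j b"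
      for i j a b
      using f(2)[rule_format, of i j a b] that by simp
    have "finite V" "card V = q * n"
      using rbibd by (auto simp: RBIBD_def BIBD_def)
    \<comment> \<open>The design may live on any set of naturals, so its points are renumbered to
      match the pigeons.\<close>
    then obtain h where h: "bij_betw h {..<q * n} V"
      using ex_bij_betw_nat_finite[of V] by (auto simp: atLeast0LessThan)
    have hV: "h a \<in> V" if "a < q * n" for a
      using h that by (auto simp: bij_betw_def)
    have h_neq: "h a \<noteq> h b" if "a < q * n" "b < q * n" "a \<noteq> b" for a b
      using h that by (auto simp: bij_betw_def inj_on_def)
    \<comment> \<open>Instances of \<open>id_problem\<close> start at 1, classes at 0.\<close>
    let ?f = "\<lambda>j a. f (j - 1) (h a)"
    show "\<exists>f. (\<forall>j\<in>{1..k}. f j \<in> {..<q * n} \<rightarrow> {..<n}) \<and>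
      (\<forall>i\<in>{1..k}. \<forall>j\<in>{1..k}. \<forall>a<q * n. \<forall>b<q * n.
         a \<noteq> b \<and> f i a = f i b \<and> f j a = f j b \<longrightarrow> i = j)"
    proof (intro exI[of _ ?f] conjI ballI allI impI)
      fix j assume "j \<in> {1..k}"
      then have "f (j - 1) \<in> V \<rightarrow> {..<n}"
        by (intro maps) auto
      then show "?f j \<in> {..<q * n} \<rightarrow> {..<n}"
        using hV by (simp add: Pi_iff)
    next
      fix i j a b
      assume *: "i \<in> {1..k}" "j \<in> {1..k}" "a < q * n" "b < q * n"
        "a \<noteq> b \<and> ?f i a = ?f i b \<and> ?f j a = ?f j b"
      have "i - 1 = j - 1"
        by (rule disj[of _ _ "h a" "h b"]) (use * hV h_neq in auto)
      \<comment> \<open>Truncated subtraction of 1 is injective only on positive indices.\<close>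
      moreover have "i \<ge> 1" "j \<ge> 1"
        using * by auto
      ultimately show "i = j" by linarith
    qed
  qed
qed

end
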